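(* Let $t_i<t_f$ and let $(m,w,f)$ be a trajectory on $[t_i,t_f]$ of the continuous dynamics of the Petri net with free choice and priority routing. Suppose that there is a policy $\pi^*$ which reaches the infimum for all times $t\in[t_i,t_f]$. Then on $[t_i,t_f]$ the dynamics reduces to the linear system $$C^-_{\pi^*}f(t)=S_{\pi^*}\Big(\frac{m(t)}{\tau}\Big),\quad \dot m(t)=C^+f(t)-\frac{m(t)}{\tau},\quad \dot w(t)=\frac{m(t)}{\tau}-C^-f(t),\quad S_{\pi^*}w(t)=0,$$ and this linear system admits a unique solution $(m,w,f)$ on $[t_i,t_f]$, given the initial conditions $(m(t_i),w(t_i))$.
   Context: Net. A Petri net consists of a finite set $\mathcal P$ of places, a finite set $\mathcal Q$ of transitions, and valuations $a^+_{qp}\in\mathbb N$ of the arc from transition $q$ to place $p$ and $a^-_{qp}\in\mathbb N$ of the arc from place $p$ to transition $q$ (value $0$ meaning no arc). The net is pure: for each $(q,p)$ at least one of $a^+_{qp},a^-_{qp}$ is $0$. $C^+,C^-$ are the $\mathcal P\times\mathcal Q$ matrices with $(p,q)$ entries $a^+_{qp}$, $a^-_{qp}$. Write $q^{\mathrm{in}}=\{p: a^-_{qp}>0\}$ and $p^{\mathrm{out}}=\{q:a^-_{qp}>0\}$. The net is strongly connected and autonomous; in particular each transition has at least one upstream place. Every place is either free choice (either $q^{\mathrm{in}}=\{p\}$ for all $q\in p^{\mathrm{out}}$, or $|p^{\mathrm{out}}|=1$) or subject to priority. $\mathcal P_{\mathsf{conflict}}$ is the set of free choice places with at least two output transitions;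 $\mathcal P_{\mathsf{priority}}$ is the set of places subject to priority; $\mathcal Q_{\mathsf{sync}}$ is the set of transitions all of whose upstream places $p$ are free choice with $|p^{\mathrm{out}}|=1$. Each $p\in\mathcal P_{\mathsf{priority}}$ has exactly two output transitions, $q_+=q_+(p)$ (with priority) and $q_-=q_-(p)$; each transition has at most one upstream place in $\mathcal P_{\mathsf{priority}}$. Each place has a time constant $\tau_p>0$, and for $p\in\mathcal P_{\mathsf{conflict}}$, $q\in p^{\mathrm{out}}$ there are weights $\mu_{qp}>0$ with $\sum_{q\in p^{\mathrm{out}}}\mu_{qp}=1$. Denote by $m/\tau$ the vector $(m_p/\tau_p)_{p\in\mathcal P}$. Dynamics. A trajectory of the continuous dynamics on a time interval is a triple $(m,w,f)$ of functions with values in $\mathbb R_{\ge0}^{\mathcal P},\mathbb R_{\ge0}^{\mathcal P},\mathbb R_{\ge0}^{\mathcal Q}$, with $m,w$ locally absolutely continuous and $f$ locally integrable, such that $\dot m=C^+f-m/\tau$ and $\dot w=m/\tau-C^-f$ for almost every $t$, and for every $t$: each transition $q$ has an upstream place $p$ with $w_p(t)=0$, and (a minimum over the empty set being $+\infty$) - for $q\in\mathcal Q_{\mathsf{sync}}$: $f_q(t)=\min_{p\in q^{\mathrm{in}},w_p(t)=0}\frac{m_p(t)}{a^-_{qp}\tau_p}$; - for $p\in\mathcal P_{\mathsf{conflict}}$, $q\in p^{\mathrm{out}}$: $a^-_{qp}f_q(t)=\mu_{qp}\frac{m_p(t)}{\tau_p}$; - for $p\in\mathcal P_{\mathsf{priority}}$: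 $f_{q_+}(t)=\min_{r\in q_+^{\mathrm{in}},w_r(t)=0}\frac{m_r(t)}{a^-_{q_+r}\tau_r}$, and $f_{q_-}(t)=\min_{r\in q_-^{\mathrm{in}}\setminus\{p\},w_r(t)=0}\frac{m_r(t)}{a^-_{q_-r}\tau_r}$ if $w_p(t)\ne0$, while if $w_p(t)=0$, $f_{q_-}(t)=\min\Big(\frac{m_p(t)}{a^-_{q_-p}\tau_p}-\frac{a^-_{q_+p}}{a^-_{q_-p}}f_{q_+}(t),\ \min_{r\in q_-^{\mathrm{in}}\setminus\{p\},w_r(t)=0}\frac{m_r(t)}{a^-_{q_-r}\tau_r}\Big)$. Policies. A policy $\pi$ maps each transition $q$ to one of its upstream places $p_\pi(q)\in q^{\mathrm{in}}$. $S_\pi$ is the $\mathcal Q\times\mathcal P$ matrix with $(S_\pi)_{qp}=1$ if $p=p_\pi(q)$ and $0$ otherwise. $C^-_\pi$ is the (invertible) $\mathcal Q\times\mathcal Q$ matrix such that, with $p=p_\pi(q)$: $(C^-_\pi f)_q=a^-_{qp}f_q$ if $p\notin\mathcal P_{\mathsf{conflict}}\cup\mathcal P_{\mathsf{priority}}$; $(C^-_\pi f)_q=\frac{a^-_{qp}}{\mu_{qp}}f_q$ if $p\in\mathcal P_{\mathsf{conflict}}$; $(C^-_\pi f)_q=a^-_{qp}f_q$ if $p\in\mathcal P_{\mathsf{priority}}$ and $q=q_+(p)$; $(C^-_\pi f)_q=a^-_{qp}f_q+a^-_{q_+p}f_{q_+}$ if $p\in\mathcal P_{\mathsf{priority}}$,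 $q=q_-(p)$ and $q_+=q_+(p)$. The flow is viewed as $f(t)=\inf_{\pi:\,S_\pi w(t)=0}(C^-_\pi)^{-1}S_\pi(m(t)/\tau)$; a policy $\pi$ is said to reach the infimum at time $t$ if $S_\pi w(t)=0$ and $f(t)=(C^-_\pi)^{-1}S_\pi(m(t)/\tau)$. *)

theory Defs
  imports "HOL-Analysis.Analysis"
begin

section \<open>Absolute continuity\<close>

definition abs_continuous_on :: "real set \<Rightarrow> (real \<Rightarrow> 'a::metric_space) \<Rightarrow> bool" where
  "abs_continuous_on S g \<longleftrightarrow>
     (\<forall>\<epsilon>>0. \<exists>\<delta>>0. \<forall>D :: (real \<times> real) set.
        finite D \<and> (\<forall>(x, y)\<in>D. x \<le> y \<and> {x..y} \<subseteq> S) \<and>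
        disjoint_family_on (\<lambda>(x, y). {x<..<y}) D \<and> (\<Sum>(x, y)\<in>D. y - x) < \<delta> \<longrightarrow>
        (\<Sum>(x, y)\<in>D. dist (g x) (g y)) < \<epsilon>)"

definition locally_abs_continuous_on :: "real set \<Rightarrow> (real \<Rightarrow> 'a::metric_space) \<Rightarrow> bool" where
  "locally_abs_continuous_on I g \<longleftrightarrow> (\<forall>a b. {a..b} \<subseteq> I \<longrightarrow> abs_continuous_on {a..b} g)"

definition locally_integrable_on :: "real set \<Rightarrow> (real \<Rightarrow> 'a::euclidean_space) \<Rightarrow> bool" where
  "locally_integrable_on I g \<longleftrightarrow> (\<forall>a b. {a..b} \<subseteq> I \<longrightarrow> g absolutely_integrable_on {a..b})"


section \<open>Petri nets with free choice and priority routing\<close>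

text \<open>
  Places are the elements of the finite type \<open>'p\<close>, transitions those of the finite type \<open>'q\<close>.
  \<open>aout q p\<close> is the valuation \<open>a\<^sup>+\<close> of the arc from \<open>q\<close> to \<open>p\<close>, and \<open>ain q p\<close> the
  valuation \<open>a\<^sup>-\<close> of the arc from \<open>p\<close> to \<open>q\<close>.
  The fields \<open>qplus\<close> and \<open>qminus\<close> are meaningful only on \<open>prio\<close>, and \<open>mu q p\<close> only
  if \<open>p\<close> is a conflict place and \<open>q\<close> one of its output transitions.
\<close>

record ('p, 'q) net =
  aout :: "'q \<Rightarrow> 'p \<Rightarrow> nat"
  ain :: "'q \<Rightarrow> 'p \<Rightarrow> nat"
  prio :: "'p set"
  qplus :: "'p \<Rightarrow> 'q"
  qminus :: "'p \<Rightarrow> 'q"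
  tau :: "'p \<Rightarrow> real"
  mu :: "'q \<Rightarrow> 'p \<Rightarrow> real"

definition q_in :: "('p::finite, 'q::finite) net \<Rightarrow> 'q \<Rightarrow> 'p set" where
  "q_in N q = {p. ain N q p > 0}"

definition p_out :: "('p::finite, 'q::finite) net \<Rightarrow> 'p \<Rightarrow> 'q set" where
  "p_out N p = {q. ain N q p > 0}"

text \<open>
  Free choice and priority are alternative routing rules: a place whose tokens are routed by
  priority does not count as free choice, even if it is the only upstream place of both of its
  output transitions.
\<close>

definition free_choice :: "('p::finite, 'q::finite) net \<Rightarrow> 'p \<Rightarrow> bool" where
  "free_choice N p \<longleftrightarrow>
     p \<notin> prio N \<and> ((\<forall>q\<in>p_out N p. q_in N q = {p}) \<or> card (p_out N p) = 1)"

definition conflict :: "('p::finite, 'q::finite) net \<Rightarrow> 'p set" where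
  "conflict N = {p. free_choice N p \<and> card (p_out N p) \<ge> 2}"

definition sync :: "('p::finite, 'q::finite) net \<Rightarrow> 'q set" where
  "sync N = {q. \<forall>p\<in>q_in N q. free_choice N p \<and> card (p_out N p) = 1}"

definition arcs :: "('p::finite, 'q::finite) net \<Rightarrow> ('p + 'q) rel" where
  "arcs N = {(Inl p, Inr q) | p q. ain N q p > 0} \<union> {(Inr q, Inl p) | p q. aout N q p > 0}"

definition strongly_connected_net :: "('p::finite, 'q::finite) net \<Rightarrow> bool" where
  "strongly_connected_net N \<longleftrightarrow> (\<forall>x y. (x, y) \<in> (arcs N)\<^sup>*)"

definition petri_net :: "('p::finite, 'q::finite) net \<Rightarrow> bool" where
  "petri_net N \<longleftrightarrow>
     (\<forall>q p. aout N q p = 0 \<or> ain N q p = 0) \<and>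
     strongly_connected_net N \<and>
     (\<forall>q. q_in N q \<noteq> {}) \<and>
     (\<forall>p. free_choice N p \<or> p \<in> prio N) \<and>
     (\<forall>p\<in>prio N. qplus N p \<noteq> qminus N p \<and> p_out N p = {qplus N p, qminus N p}) \<and>
     (\<forall>q. card (q_in N q \<inter> prio N) \<le> 1) \<and>
     (\<forall>p. tau N p > 0) \<and>
     (\<forall>p\<in>conflict N. (\<forall>q\<in>p_out N p. mu N q p > 0) \<and> (\<Sum>q\<in>p_out N p. mu N q p) = 1)"


section \<open>Continuous dynamics\<close>

definition Cplus :: "('p::finite, 'q::finite) net \<Rightarrow> real ^ 'q ^ 'p" where
  "Cplus N = (\<chi> p q. real (aout N q p))"

definition Cminus :: "('p::finite, 'q::finite) net \<Rightarrow> real ^ 'q ^ 'p" where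
  "Cminus N = (\<chi> p q. real (ain N q p))"

definition over_tau :: "('p::finite, 'q::finite) net \<Rightarrow> real ^ 'p \<Rightarrow> real ^ 'p" where
  "over_tau N m = (\<chi> p. m $ p / tau N p)"

text \<open>
  Minimum over the places \<open>r \<in> R\<close> with \<open>w\<^sub>r = 0\<close>; since \<open>R\<close> is finite, the infimum in the
  extended reals is this minimum, with value \<open>\<infinity>\<close> over the empty set.
\<close>

definition min_flow ::
  "('p::finite, 'q::finite) net \<Rightarrow> real ^ 'p \<Rightarrow> real ^ 'p \<Rightarrow> 'q \<Rightarrow> 'p set \<Rightarrow> ereal" where
  "min_flow N m w q R = (INF r\<in>{r\<in>R. w $ r = 0}. ereal (m $ r / (real (ain N q r) * tau N r)))"

definition flow_rules ::
  "('p::finite, 'q::finite) net \<Rightarrow> real ^ 'p \<Rightarrow> real ^ 'p \<Rightarrow> real ^ 'q \<Rightarrow> bool" where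
  "flow_rules N m w f \<longleftrightarrow>
     (\<forall>q. \<exists>p\<in>q_in N q. w $ p = 0) \<and>
     (\<forall>q\<in>sync N. ereal (f $ q) = min_flow N m w q (q_in N q)) \<and>
     (\<forall>p\<in>conflict N. \<forall>q\<in>p_out N p. real (ain N q p) * f $ q = mu N q p * (m $ p / tau N p)) \<and>
     (\<forall>p\<in>prio N.
        let qp = qplus N p; qm = qminus N p in
        ereal (f $ qp) = min_flow N m w qp (q_in N qp) \<and>
        ereal (f $ qm) =
          (if w $ p \<noteq> 0 then min_flow N m w qm (q_in N qm - {p})
           else min
             (ereal (m $ p / (real (ain N qm p) * tau N p)
                     - real (ain N qp p) / real (ain N qm p) * f $ qp))
             (min_flow N m w qm (q_in N qm - {p}))))"

definition trajectory ::
  "('p::finite, 'q::finite) net \<Rightarrow> real set \<Rightarrow>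
    (real \<Rightarrow> real ^ 'p) \<Rightarrow> (real \<Rightarrow> real ^ 'p) \<Rightarrow> (real \<Rightarrow> real ^ 'q) \<Rightarrow> bool" where
  "trajectory N I m w f \<longleftrightarrow>
     (\<forall>t\<in>I. (\<forall>p. m t $ p \<ge> 0) \<and> (\<forall>p. w t $ p \<ge> 0) \<and> (\<forall>q. f t $ q \<ge> 0)) \<and>
     locally_abs_continuous_on I m \<and>
     locally_abs_continuous_on I w \<and>
     locally_integrable_on I f \<and>
     (AE t in lebesgue. t \<in> I \<longrightarrow>
        (m has_vector_derivative (Cplus N *v f t - over_tau N (m t))) (at t within I) \<and>
        (w has_vector_derivative (over_tau N (m t) - Cminus N *v f t)) (at t within I)) \<and>
     (\<forall>t\<in>I. flow_rules N (m t) (w t) (f t))"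


section \<open>Policies and the associated linear systems\<close>

definition policy :: "('p::finite, 'q::finite) net \<Rightarrow> ('q \<Rightarrow> 'p) \<Rightarrow> bool" where
  "policy N \<pi> \<longleftrightarrow> (\<forall>q. \<pi> q \<in> q_in N q)"

definition Spol :: "('q::finite \<Rightarrow> 'p::finite) \<Rightarrow> real ^ 'p ^ 'q" where
  "Spol \<pi> = (\<chi> q p. if p = \<pi> q then 1 else 0)"

definition Cpol :: "('p::finite, 'q::finite) net \<Rightarrow> ('q \<Rightarrow> 'p) \<Rightarrow> real ^ 'q ^ 'q" where
  "Cpol N \<pi> = (\<chi> q q'.
     let p = \<pi> q in
     if q' = q then (if p \<in> conflict N then real (ain N q p) / mu N q p else real (ain N q p))
     else if p \<in> prio N \<and> q = qminus N p \<and> q' = qplus N p then real (ain N q' p)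
     else 0)"

definition reaches_infimum ::
  "('p::finite, 'q::finite) net \<Rightarrow> ('q \<Rightarrow> 'p) \<Rightarrow>
    real ^ 'p \<Rightarrow> real ^ 'p \<Rightarrow> real ^ 'q \<Rightarrow> bool" where
  "reaches_infimum N \<pi> m w f \<longleftrightarrow>
     Spol \<pi> *v w = 0 \<and> f = matrix_inv (Cpol N \<pi>) *v (Spol \<pi> *v over_tau N m)"

text \<open>
  Solutions are meant in the same sense as for trajectories: the two differential equations hold
  almost everywhere, the two algebraic equations everywhere. No sign condition is imposed.
\<close>

definition linear_solution ::
  "('p::finite, 'q::finite) net \<Rightarrow> ('q \<Rightarrow> 'p) \<Rightarrow> real set \<Rightarrow>
    (real \<Rightarrow> real ^ 'p) \<Rightarrow> (real \<Rightarrow> real ^ 'p) \<Rightarrow> (real \<Rightarrow> real ^ 'q) \<Rightarrow> bool" where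
  "linear_solution N \<pi> I m w f \<longleftrightarrow>
     locally_abs_continuous_on I m \<and>
     locally_abs_continuous_on I w \<and>
     locally_integrable_on I f \<and>
     (\<forall>t\<in>I. Cpol N \<pi> *v f t = Spol \<pi> *v over_tau N (m t)) \<and>
     (AE t in lebesgue. t \<in> I \<longrightarrow>
        (m has_vector_derivative (Cplus N *v f t - over_tau N (m t))) (at t within I) \<and>
        (w has_vector_derivative (over_tau N (m t) - Cminus N *v f t)) (at t within I)) \<and>
     (\<forall>t\<in>I. Spol \<pi> *v w t = 0)"

end

theory Submission
  imports Defs
begin

text \<open>
  The matrix of a policy is invertible because it is triangular once the transitions are suitably
  ordered: an off-diagonal entry occurs only in the row of a transition \<open>q\<^sub>-\<close> whose policy place
  \<open>p\<close> is subject to priority, and it lies in the column of the companion \<open>q\<^sub>+\<close>. Since \<open>q\<^sub>+\<close> has no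
  priority place upstream other than \<open>p\<close>, its own row is diagonal (\<open>invertible_Cpol\<close>). Multiplying
  the formula for the flow that reaches the infimum by this matrix gives the algebraic equation of
  the linear system, \<open>S w = 0\<close> is part of reaching the infimum, and the two differential equations
  are those of the trajectory.

  For uniqueness, the algebraic equation expresses \<open>f\<close> as a linear function of \<open>m\<close>. So the
  difference of the markings of two solutions is absolutely continuous, vanishes initially, and
  satisfies almost everywhere a linear equation \<open>x' = L x\<close>. It then vanishes identically by a
  Gronwall argument, hence the flows agree, the difference of the \<open>w\<close> components has derivative \<open>0\<close>
  almost everywhere, and it vanishes too, by the same lemma (\<open>abs_continuous_on_gronwall_zero\<close>).

  As derivatives exist only almost everywhere, the analytic core is a mean value inequality for
  absolutely continuous functions (\<open>abs_continuous_on_increment_le\<close>): a bound on the derivative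
  outside a null set bounds the increment. It is obtained from a tagged division of the interval:
  cells tagged outside the null set are controlled by the derivative, and the cells tagged inside
  it have small total length, so that absolute continuity makes their contribution small.
\<close>

section \<open>Absolutely continuous functions\<close>

lemma abs_continuous_onE:
  assumes "abs_continuous_on S g" "\<epsilon> > 0"
  obtains \<delta> where "\<delta> > 0"
    "\<And>D. finite D \<Longrightarrow> \<forall>(x, y)\<in>D. x \<le> y \<and> {x..y} \<subseteq> S \<Longrightarrow>
       disjoint_family_on (\<lambda>(x, y). {x<..<y}) D \<Longrightarrow> (\<Sum>(x, y)\<in>D. y - x) < \<delta> \<Longrightarrow>
       (\<Sum>(x, y)\<in>D. dist (g x) (g y)) < \<epsilon>"
proof -
  from mp[OF spec[OF assms(1)[unfolded abs_continuous_on_def], of \<epsilon>] assms(2)]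
  show thesis by (elim exE conjE) (rule that, assumption, blast)
qed

lemma abs_continuous_onI:
  assumes "\<And>\<epsilon>. \<epsilon> > 0 \<Longrightarrow> \<exists>\<delta>>0. \<forall>D. finite D \<longrightarrow> (\<forall>(x, y)\<in>D. x \<le> y \<and> {x..y} \<subseteq> S) \<longrightarrow>
       disjoint_family_on (\<lambda>(x, y). {x<..<y}) D \<longrightarrow> (\<Sum>(x, y)\<in>D. y - x) < \<delta> \<longrightarrow>
       (\<Sum>(x, y)\<in>D. dist (g x) (g y)) < \<epsilon>"
  shows "abs_continuous_on S g"
  unfolding abs_continuous_on_def
proof (intro allI impI)
  fix \<epsilon> :: real assume "\<epsilon> > 0"
  from assms[OF this]
  show "\<exists>\<delta>>0. \<forall>D :: (real \<times> real) set.
      finite D \<and> (\<forall>(x, y)\<in>D. x \<le> y \<and> {x..y} \<subseteq> S) \<and>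
      disjoint_family_on (\<lambda>(x, y). {x<..<y}) D \<and> (\<Sum>(x, y)\<in>D. y - x) < \<delta> \<longrightarrow>
      (\<Sum>(x, y)\<in>D. dist (g x) (g y)) < \<epsilon>"
    by (simp only: imp_conjL)
qed

lemma abs_continuous_on_subset:
  assumes "abs_continuous_on T g" "S \<subseteq> T"
  shows "abs_continuous_on S g"
proof (rule abs_continuous_onI)
  fix \<epsilon> :: real assume "\<epsilon> > 0"
  obtain \<delta> where "\<delta> > 0" and \<delta>:
    "\<And>D. finite D \<Longrightarrow> \<forall>(x, y)\<in>D. x \<le> y \<and> {x..y} \<subseteq> T \<Longrightarrow>
       disjoint_family_on (\<lambda>(x, y). {x<..<y}) D \<Longrightarrow> (\<Sum>(x, y)\<in>D. y - x) < \<delta> \<Longrightarrow>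
       (\<Sum>(x, y)\<in>D. dist (g x) (g y)) < \<epsilon>"
    by (rule abs_continuous_onE[OF assms(1) \<open>\<epsilon> > 0\<close>]) blast
  have "(\<Sum>(x, y)\<in>D. dist (g x) (g y)) < \<epsilon>"
    if D: "finite D" "\<forall>(x, y)\<in>D. x \<le> y \<and> {x..y} \<subseteq> S"
      "disjoint_family_on (\<lambda>(x, y). {x<..<y}) D" "(\<Sum>(x, y)\<in>D. y - x) < \<delta>" for D
    by (rule \<delta>[OF D(1) _ D(3,4)]) (use D(2) assms(2) in fast)
  then show "\<exists>\<delta>>0. \<forall>D. finite D \<longrightarrow> (\<forall>(x, y)\<in>D. x \<le> y \<and> {x..y} \<subseteq> S) \<longrightarrow>
       disjoint_family_on (\<lambda>(x, y). {x<..<y}) D \<longrightarrow> (\<Sum>(x, y)\<in>D. y - x) < \<delta> \<longrightarrow>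
       (\<Sum>(x, y)\<in>D. dist (g x) (g y)) < \<epsilon>"
    using \<open>\<delta> > 0\<close> by (intro exI[of _ \<delta>] conjI allI impI)
qed

lemma abs_continuous_on_diff:
  fixes g h :: "real \<Rightarrow> 'a::real_normed_vector"
  assumes "abs_continuous_on S g" "abs_continuous_on S h"
  shows "abs_continuous_on S (\<lambda>t. g t - h t)"
proof (rule abs_continuous_onI)
  fix \<epsilon> :: real assume "\<epsilon> > 0"
  then have "\<epsilon> / 2 > 0" by simp
  obtain \<delta>1 where "\<delta>1 > 0" and \<delta>1:
    "\<And>D. finite D \<Longrightarrow> \<forall>(x, y)\<in>D. x \<le> y \<and> {x..y} \<subseteq> S \<Longrightarrow>
       disjoint_family_on (\<lambda>(x, y). {x<..<y}) D \<Longrightarrow> (\<Sum>(x, y)\<in>D. y - x) < \<delta>1 \<Longrightarrow>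
       (\<Sum>(x, y)\<in>D. dist (g x) (g y)) < \<epsilon> / 2"
    by (rule abs_continuous_onE[OF assms(1) \<open>\<epsilon> / 2 > 0\<close>]) blast
  obtain \<delta>2 where "\<delta>2 > 0" and \<delta>2:
    "\<And>D. finite D \<Longrightarrow> \<forall>(x, y)\<in>D. x \<le> y \<and> {x..y} \<subseteq> S \<Longrightarrow>
       disjoint_family_on (\<lambda>(x, y). {x<..<y}) D \<Longrightarrow> (\<Sum>(x, y)\<in>D. y - x) < \<delta>2 \<Longrightarrow>
       (\<Sum>(x, y)\<in>D. dist (h x) (h y)) < \<epsilon> / 2"
    by (rule abs_continuous_onE[OF assms(2) \<open>\<epsilon> / 2 > 0\<close>]) blast
  have "(\<Sum>(x, y)\<in>D. dist (g x - h x) (g y - h y)) < \<epsilon>"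
    if D: "finite D" "\<forall>(x, y)\<in>D. x \<le> y \<and> {x..y} \<subseteq> S"
      "disjoint_family_on (\<lambda>(x, y). {x<..<y}) D" "(\<Sum>(x, y)\<in>D. y - x) < min \<delta>1 \<delta>2" for D
  proof -
    have "(\<Sum>(x, y)\<in>D. dist (g x - h x) (g y - h y))
        \<le> (\<Sum>(x, y)\<in>D. dist (g x) (g y) + dist (h x) (h y))"
    proof (intro sum_mono, clarify)
      fix x y
      have "g x - h x - (g y - h y) = (g x - g y) - (h x - h y)" by simp
      then show "dist (g x - h x) (g y - h y) \<le> dist (g x) (g y) + dist (h x) (h y)"
        by (simp only: dist_norm norm_triangle_ineq4)
    qed
    also have "\<dots> = (\<Sum>(x, y)\<in>D. dist (g x) (g y)) + (\<Sum>(x, y)\<in>D. dist (h x) (h y))"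
      by (simp add: case_prod_beta sum.distrib)
    also have "\<dots> < \<epsilon>"
      using \<delta>1[OF D(1-3)] \<delta>2[OF D(1-3)] D(4) by linarith
    finally show ?thesis .
  qed
  then show "\<exists>\<delta>>0. \<forall>D. finite D \<longrightarrow> (\<forall>(x, y)\<in>D. x \<le> y \<and> {x..y} \<subseteq> S) \<longrightarrow>
       disjoint_family_on (\<lambda>(x, y). {x<..<y}) D \<longrightarrow> (\<Sum>(x, y)\<in>D. y - x) < \<delta> \<longrightarrow>
       (\<Sum>(x, y)\<in>D. dist (g x - h x) (g y - h y)) < \<epsilon>"
    using \<open>\<delta>1 > 0\<close> \<open>\<delta>2 > 0\<close> by (intro exI[of _ "min \<delta>1 \<delta>2"] conjI allI impI) simp_all
qed

lemma abs_continuous_on_imp_continuous_on: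
  assumes "abs_continuous_on {a..b} g"
  shows "continuous_on {a..b} g"
  unfolding continuous_on_iff
proof (intro ballI allI impI)
  fix x \<epsilon> :: real assume x: "x \<in> {a..b}" and "\<epsilon> > 0"
  obtain \<delta> where "\<delta> > 0" and \<delta>:
    "\<And>D. finite D \<Longrightarrow> \<forall>(x, y)\<in>D. x \<le> y \<and> {x..y} \<subseteq> {a..b} \<Longrightarrow>
       disjoint_family_on (\<lambda>(x, y). {x<..<y}) D \<Longrightarrow> (\<Sum>(x, y)\<in>D. y - x) < \<delta> \<Longrightarrow>
       (\<Sum>(x, y)\<in>D. dist (g x) (g y)) < \<epsilon>"
    by (rule abs_continuous_onE[OF assms \<open>\<epsilon> > 0\<close>]) blast
  have less: "dist (g s) (g t) < \<epsilon>" if "s \<le> t" "s \<in> {a..b}" "t \<in> {a..b}" "t - s < \<delta>" for s t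
    using \<delta>[of "{(s, t)}"] that by (simp add: disjoint_family_on_def)
  have "dist (g y) (g x) < \<epsilon>" if "y \<in> {a..b}" "dist y x < \<delta>" for y
  proof (cases "x \<le> y")
    case True
    then show ?thesis using less[of x y] that x by (simp add: dist_commute dist_real_def)
  next
    case False
    then show ?thesis using less[of y x] that x by (simp add: dist_real_def)
  qed
  then show "\<exists>d>0. \<forall>x'\<in>{a..b}. dist x' x < d \<longrightarrow> dist (g x') (g x) < \<epsilon>"
    using \<open>\<delta> > 0\<close> by blast
qed

text \<open>
  A null set has an open neighbourhood of measure less than the \<open>\<delta>\<close> that absolute continuity
  assigns to \<open>\<epsilon>\<close>, and the cells of a partial division that lie in this neighbourhood are admissible
  intervals of total length less than \<open>\<delta>\<close>.
\<close>

lemma abs_continuous_on_small_near_null_set: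
  fixes g :: "real \<Rightarrow> 'a::real_normed_vector"
  assumes ac: "abs_continuous_on {a..b} g" and Z: "Z \<in> null_sets lebesgue" and "\<epsilon> > 0"
  obtains U where "open U" "Z \<subseteq> U"
    "\<And>p. p tagged_partial_division_of {a..b} \<Longrightarrow> (\<And>x K. (x, K) \<in> p \<Longrightarrow> K \<subseteq> U) \<Longrightarrow>
       (\<Sum>(x, K)\<in>p. norm (g (Sup K) - g (Inf K))) < \<epsilon>"
proof -
  obtain \<delta> where "\<delta> > 0" and \<delta>:
    "\<And>D. finite D \<Longrightarrow> \<forall>(x, y)\<in>D. x \<le> y \<and> {x..y} \<subseteq> {a..b} \<Longrightarrow>
       disjoint_family_on (\<lambda>(x, y). {x<..<y}) D \<Longrightarrow> (\<Sum>(x, y)\<in>D. y - x) < \<delta> \<Longrightarrow>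
       (\<Sum>(x, y)\<in>D. dist (g x) (g y)) < \<epsilon>"
    by (rule abs_continuous_onE[OF ac \<open>\<epsilon> > 0\<close>]) blast
  have "Z \<in> sets lebesgue" using Z by blast
  then obtain U where U: "open U" "Z \<subseteq> U" "U - Z \<in> lmeasurable" "emeasure lebesgue (U - Z) < ennreal \<delta>"
    using sets_lebesgue_outer_open \<open>\<delta> > 0\<close> by metis
  have "emeasure lebesgue U = emeasure lebesgue (U - Z)"
    using Z U(1) by (simp add: emeasure_Diff_null_set)
  then have emU: "emeasure lebesgue U < ennreal \<delta>" using U by simp
  have Umeas: "U \<in> lmeasurable"
    using emU U(1) by (intro fmeasurableI) (auto simp: less_top[symmetric] intro: order.strict_trans2)
  have mU: "measure lebesgue U < \<delta>"
    using emU Umeas by (simp add: emeasure_eq_measure2 ennreal_less_iff)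
  have "(\<Sum>(x, K)\<in>p. norm (g (Sup K) - g (Inf K))) < \<epsilon>"
    if p: "p tagged_partial_division_of {a..b}" and pU: "\<And>x K. (x, K) \<in> p \<Longrightarrow> K \<subseteq> U" for p
  proof -
    let ?ends = "\<lambda>K::real set. (Inf K, Sup K)"
    let ?D = "snd ` p"
    have tag: "p tagged_division_of (\<Union>(snd ` p))"
      by (rule tagged_partial_division_of_Union_self[OF p])
    have div: "?D division_of (\<Union>?D)"
      by (rule division_of_tagged_division[OF tag])
    have K: "\<exists>u v. u \<le> v \<and> K = {u..v} \<and> {u..v} \<subseteq> {a..b}" if "K \<in> ?D" for K
    proof -
      from that obtain x where x: "(x, K) \<in> p" by auto
      then obtain u v where "K = cbox u v" "x \<in> K" "K \<subseteq> {a..b}"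
        using tagged_partial_division_ofD[OF p] by metis
      then show ?thesis by (auto simp: cbox_interval)
    qed
    have inj: "inj_on ?ends ?D"
    proof (rule inj_onI)
      fix K L assume "K \<in> ?D" "L \<in> ?D" and eq: "?ends K = ?ends L"
      then obtain u v u' v' where "u \<le> v" "K = {u..v}" "u' \<le> v'" "L = {u'..v'}"
        using K by metis
      then show "K = L" using eq by simp
    qed
    \<comment> \<open>Tags may share a degenerate interval, so passing from \<open>p\<close> to \<open>?D\<close> requires a summand
      that vanishes on these; it must also vanish on \<open>{}\<close>, where \<open>Sup\<close> and \<open>Inf\<close> are arbitrary.\<close>
    let ?h = "\<lambda>K. if K = {} then 0 else norm (g (Sup K) - g (Inf K))"
    have "(\<Sum>(x, K)\<in>p. norm (g (Sup K) - g (Inf K))) = (\<Sum>(x, K)\<in>p. ?h K)"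
    proof (intro sum.cong refl, clarify)
      fix x K assume "(x, K) \<in> p"
      then have "K \<noteq> {}" using tagged_division_ofD(2)[OF tag] by blast
      then show "norm (g (Sup K) - g (Inf K)) = ?h K" by simp
    qed
    also have "\<dots> = (\<Sum>K\<in>?D. ?h K)"
    proof (rule sum.over_tagged_division_lemma[OF tag])
      fix u v :: real assume "box u v = {}"
      then have "v \<le> u" by simp
      then show "?h (cbox u v) = 0" by (cases "u = v") auto
    qed
    also have "\<dots> = (\<Sum>K\<in>?D. norm (g (Sup K) - g (Inf K)))"
    proof (intro sum.cong refl)
      fix L assume "L \<in> ?D"
      then have "L \<noteq> {}" using K[of L] by auto
      then show "?h L = norm (g (Sup L) - g (Inf L))" by simp
    qed
    also have "\<dots> = (\<Sum>(x, y)\<in>?ends ` ?D. dist (g x) (g y))"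
      by (simp add: sum.reindex[OF inj] dist_norm norm_minus_commute)
    also have "\<dots> < \<epsilon>"
    proof (rule \<delta>)
      show "finite (?ends ` ?D)" using division_ofD(1)[OF div] by blast
      show "\<forall>(x, y)\<in>?ends ` ?D. x \<le> y \<and> {x..y} \<subseteq> {a..b}"
        using K by fastforce
      show "disjoint_family_on (\<lambda>(x, y). {x<..<y}) (?ends ` ?D)"
        unfolding disjoint_family_on_def
      proof (intro ballI impI)
        fix A B assume AB: "A \<in> ?ends ` ?D" "B \<in> ?ends ` ?D" "A \<noteq> B"
        then obtain K L where KL: "K \<in> ?D" "L \<in> ?D" "A = ?ends K" "B = ?ends L" by auto
        obtain u v u' v' where uv: "u \<le> v" "K = {u..v}" "u' \<le> v'" "L = {u'..v'}"
          using K KL by metis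
        have "interior K \<inter> interior L = {}"
          using division_ofD(5)[OF div KL(1,2)] AB KL by blast
        then show "(case A of (x, y) \<Rightarrow> {x<..<y}) \<inter> (case B of (x, y) \<Rightarrow> {x<..<y}) = {}"
          using KL uv by (simp add: interior_atLeastAtMost_real)
      qed
      have "(\<Sum>(x, y)\<in>?ends ` ?D. y - x) = (\<Sum>K\<in>?D. Sup K - Inf K)"
        by (simp add: sum.reindex[OF inj])
      also have "\<dots> = (\<Sum>K\<in>?D. measure lebesgue K)"
      proof (rule sum.cong[OF refl])
        fix L assume "L \<in> ?D"
        then obtain u v where "u \<le> v" "L = {u..v}" using K by metis
        then show "Sup L - Inf L = measure lebesgue L" by simp
      qed
      also have "\<dots> = measure lebesgue (\<Union>?D)" by (rule content_division[OF div])
      also have "\<dots> \<le> measure lebesgue U"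
      proof (rule measure_mono_fmeasurable)
        show "\<Union>?D \<subseteq> U" using pU by fastforce
      qed (use lmeasurable_division[OF div] Umeas in auto)
      finally show "(\<Sum>(x, y)\<in>?ends ` ?D. y - x) < \<delta>" using mU by simp
    qed
    finally show ?thesis .
  qed
  then show thesis using that U by blast
qed

text \<open>
  Because \<open>x\<close> lies between \<open>s\<close> and \<open>t\<close>, the two linearisation errors are at most
  \<open>e * (x - s)\<close> and \<open>e * (t - x)\<close>, so they add up to a multiple of the cell length \<open>t - s\<close>.
  This makes the bound summable over the cells of a division.
\<close>

lemma increment_le_near_derivative:
  fixes g :: "real \<Rightarrow> 'a::real_normed_vector"
  assumes g: "(g has_vector_derivative v) (at x within S)"
    and \<phi>: "(\<phi> has_vector_derivative d) (at x within S)"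
    and le: "norm v \<le> d" and "e > 0"
  obtains r where "r > 0"
    "\<And>s t. s \<in> S \<Longrightarrow> t \<in> S \<Longrightarrow> s \<le> x \<Longrightarrow> x \<le> t \<Longrightarrow> x - s < r \<Longrightarrow> t - x < r \<Longrightarrow>
       norm (g t - g s) \<le> \<phi> t - \<phi> s + 2 * e * (t - s)"
proof -
  obtain r1 where "r1 > 0" and
    r1: "\<And>y. y \<in> S \<Longrightarrow> norm (y - x) < r1 \<Longrightarrow> norm (g y - g x - (y - x) *\<^sub>R v) \<le> e * norm (y - x)"
    using g \<open>e > 0\<close> unfolding has_vector_derivative_def has_derivative_within_alt by metis
  obtain r2 where "r2 > 0" and
    r2: "\<And>y. y \<in> S \<Longrightarrow> norm (y - x) < r2 \<Longrightarrow> norm (\<phi> y - \<phi> x - (y - x) *\<^sub>R d) \<le> e * norm (y - x)"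
    using \<phi> \<open>e > 0\<close> unfolding has_vector_derivative_def has_derivative_within_alt by metis
  show thesis
  proof (rule that[of "min r1 r2"])
    fix s t assume st: "s \<in> S" "t \<in> S" "s \<le> x" "x \<le> t" "x - s < min r1 r2" "t - x < min r1 r2"
    have gt: "norm (g t - g x - (t - x) *\<^sub>R v) \<le> e * (t - x)" and
      gs: "norm (g s - g x - (s - x) *\<^sub>R v) \<le> e * (x - s)"
      using r1[of t] r1[of s] st by auto
    have \<phi>t: "(t - x) * d - e * (t - x) \<le> \<phi> t - \<phi> x" and
      \<phi>s: "\<phi> s - \<phi> x \<le> (s - x) * d + e * (x - s)"
      using r2[of t] r2[of s] st by (auto simp: abs_le_iff)
    have "norm (g t - g s) = norm ((g t - g x - (t - x) *\<^sub>R v) - (g s - g x - (s - x) *\<^sub>R v) + (t - s) *\<^sub>R v)"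
      by (simp add: algebra_simps)
    also have "\<dots> \<le> norm (g t - g x - (t - x) *\<^sub>R v) + norm (g s - g x - (s - x) *\<^sub>R v)
        + norm ((t - s) *\<^sub>R v)"
      by (meson norm_triangle_ineq norm_triangle_ineq4 add_right_mono order_trans)
    also have "\<dots> \<le> e * (t - x) + e * (x - s) + (t - s) * norm v"
      using gt gs st by simp
    also have "\<dots> \<le> e * (t - x) + e * (x - s) + (t - s) * d"
      using le st by (simp add: mult_left_mono)
    also have "\<dots> \<le> \<phi> t - \<phi> s + 2 * e * (t - s)"
      using \<phi>t \<phi>s by (simp add: algebra_simps)
    finally show "norm (g t - g s) \<le> \<phi> t - \<phi> s + 2 * e * (t - s)" .
  qed (use \<open>r1 > 0\<close> \<open>r2 > 0\<close> in simp)
qed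

section \<open>Mean value inequality and uniqueness for absolutely continuous functions\<close>

text \<open>
  The gauge is chosen differently on the two kinds of points. Around a point of the null set it
  stays inside the small open neighbourhood; around any other point of the interval it is the
  radius on which the linearisations are accurate. Monotonicity of \<open>\<phi>\<close> lets the sum of its
  increments over the good cells be bounded by the sum over all cells, which telescopes.
\<close>

theorem abs_continuous_on_increment_le:
  fixes g :: "real \<Rightarrow> 'a::real_normed_vector"
  assumes "a \<le> b" and ac: "abs_continuous_on {a..b} g" and mono: "mono_on {a..b} \<phi>"
    and deriv: "AE t in lebesgue. t \<in> {a..b} \<longrightarrow>
      (\<exists>v d. (g has_vector_derivative v) (at t within {a..b}) \<and>
             (\<phi> has_vector_derivative d) (at t within {a..b}) \<and> norm v \<le> d)"
  shows "norm (g b - g a) \<le> \<phi> b - \<phi> a"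
proof (rule field_le_epsilon)
  fix \<eta> :: real assume "\<eta> > 0"
  define e where "e = \<eta> / (2 * (b - a) + 1)"
  have "e > 0" using \<open>\<eta> > 0\<close> \<open>a \<le> b\<close> by (simp add: e_def)
  have e: "2 * e * (b - a) + e = \<eta>"
  proof -
    have "2 * e * (b - a) + e = e * (2 * (b - a) + 1)" by (simp add: algebra_simps)
    then show ?thesis using \<open>a \<le> b\<close> by (simp add: e_def)
  qed
  obtain Z where Zd: "\<And>t. t \<notin> Z \<Longrightarrow> t \<in> {a..b} \<Longrightarrow>
      \<exists>v d. (g has_vector_derivative v) (at t within {a..b}) \<and>
            (\<phi> has_vector_derivative d) (at t within {a..b}) \<and> norm v \<le> d"
    and Z: "Z \<in> null_sets lebesgue"
    using AE_E3[OF deriv] by auto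
  obtain U where U: "open U" "Z \<subseteq> U" and small:
    "\<And>p. p tagged_partial_division_of {a..b} \<Longrightarrow> (\<And>x K. (x, K) \<in> p \<Longrightarrow> K \<subseteq> U) \<Longrightarrow>
       (\<Sum>(x, K)\<in>p. norm (g (Sup K) - g (Inf K))) < e"
    using abs_continuous_on_small_near_null_set[OF ac Z \<open>e > 0\<close>] by blast
  have "\<exists>r>0. (x \<in> Z \<longrightarrow> ball x r \<subseteq> U) \<and> (x \<notin> Z \<longrightarrow> x \<in> {a..b} \<longrightarrow>
      (\<forall>s\<in>{a..b}. \<forall>t\<in>{a..b}. s \<le> x \<longrightarrow> x \<le> t \<longrightarrow> x - s < r \<longrightarrow> t - x < r \<longrightarrow>
       norm (g t - g s) \<le> \<phi> t - \<phi> s + 2 * e * (t - s)))" for x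
  proof (cases "x \<in> Z")
    case True
    then show ?thesis using U by (meson in_mono open_contains_ball)
  next
    case False
    show ?thesis
    proof (cases "x \<in> {a..b}")
      case True
      obtain v d where vd: "(g has_vector_derivative v) (at x within {a..b})"
        "(\<phi> has_vector_derivative d) (at x within {a..b})" "norm v \<le> d"
        using Zd[OF False True] by blast
      show ?thesis
        using increment_le_near_derivative[OF vd \<open>e > 0\<close>] False by metis
    qed (use False in \<open>auto intro: exI[of _ 1]\<close>)
  qed
  then obtain r where rpos: "\<And>x. r x > 0" and rZ: "\<And>x. x \<in> Z \<Longrightarrow> ball x (r x) \<subseteq> U"
    and rgood: "\<And>x s t. \<lbrakk>x \<notin> Z; x \<in> {a..b}; s \<in> {a..b}; t \<in> {a..b}; s \<le> x; x \<le> t;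
       x - s < r x; t - x < r x\<rbrakk> \<Longrightarrow> norm (g t - g s) \<le> \<phi> t - \<phi> s + 2 * e * (t - s)"
    by metis
  have "gauge (\<lambda>x. ball x (r x))" using rpos by (intro gauge_ball_dependent) simp
  then obtain p where p: "p tagged_division_of {a..b}" and fine: "(\<lambda>x. ball x (r x)) fine p"
    by (rule fine_division_exists_real)
  have fin: "finite p" using p by blast
  let ?h = "\<lambda>(x::real, K). norm (g (Sup K) - g (Inf K))"
  let ?k = "\<lambda>(x::real, K). \<phi> (Sup K) - \<phi> (Inf K) + 2 * e * (Sup K - Inf K)"
  let ?pZ = "{(x, K)\<in>p. x \<in> Z}"
  have cell: "\<exists>s t. s \<le> x \<and> x \<le> t \<and> K = {s..t} \<and> s \<in> {a..b} \<and> t \<in> {a..b} \<and> x \<in> {a..b} \<and> K \<subseteq> ball x (r x)"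
    if xK: "(x, K) \<in> p" for x K
  proof -
    obtain s t where "K = cbox s t" using tagged_division_ofD(4)[OF p xK] by blast
    moreover have "x \<in> K" "K \<subseteq> {a..b}" using tagged_division_ofD(2,3)[OF p xK] by auto
    moreover have "K \<subseteq> ball x (r x)" using fine xK by (auto simp: fine_def)
    ultimately show ?thesis by (intro exI[of _ s] exI[of _ t]) auto
  qed
  have knn: "?k z \<ge> 0" if zp: "z \<in> p" for z
  proof -
    obtain x K where z: "z = (x, K)" by (cases z)
    obtain s t where st: "s \<le> x" "x \<le> t" "K = {s..t}" "s \<in> {a..b}" "t \<in> {a..b}"
      using cell zp z by metis
    have "\<phi> s \<le> \<phi> t" using mono st by (auto intro: mono_onD)
    then show ?thesis using st \<open>e > 0\<close> z by simp
  qed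
  have good: "?h z \<le> ?k z" if zp: "z \<in> p - ?pZ" for z
  proof -
    obtain x K where z: "z = (x, K)" by (cases z)
    then have xK: "(x, K) \<in> p" "x \<notin> Z" using zp by auto
    obtain s t where st: "s \<le> x" "x \<le> t" "K = {s..t}" "s \<in> {a..b}" "t \<in> {a..b}" "x \<in> {a..b}"
      "K \<subseteq> ball x (r x)" using cell[OF xK(1)] by blast
    then have "s \<in> K" "t \<in> K" by auto
    then have "s \<in> ball x (r x)" "t \<in> ball x (r x)" using st(7) by blast+
    then have "x - s < r x" "t - x < r x" using st by (auto simp: dist_real_def)
    then show ?thesis using rgood[OF xK(2) st(6,4,5,1,2)] st z by simp
  qed
  have "norm (g b - g a) = norm (\<Sum>(x, K)\<in>p. g (Sup K) - g (Inf K))"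
    by (simp add: additive_tagged_division_1[OF \<open>a \<le> b\<close> p])
  also have "\<dots> \<le> sum ?h p"
    by (rule order_trans[OF norm_sum]) (simp add: case_prod_beta)
  also have "\<dots> = sum ?h (p - ?pZ) + sum ?h ?pZ"
    by (rule sum.subset_diff) (use fin in auto)
  also have "\<dots> \<le> sum ?k p + e"
  proof -
    have "sum ?h (p - ?pZ) \<le> sum ?k (p - ?pZ)" by (rule sum_mono) (rule good)
    also have "\<dots> \<le> sum ?k p"
    proof (rule sum_mono2[OF fin])
      show "p - ?pZ \<subseteq> p" by blast
      show "?k z \<ge> 0" if "z \<in> p - (p - ?pZ)" for z using that by (intro knn) blast
    qed
    finally have "sum ?h (p - ?pZ) \<le> sum ?k p" .
    moreover have "sum ?h ?pZ < e"
    proof (rule small)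
      have "p tagged_partial_division_of {a..b}" using p unfolding tagged_division_of_def by blast
      then show "?pZ tagged_partial_division_of {a..b}"
        by (rule tagged_partial_division_subset) blast
      show "K \<subseteq> U" if "(x, K) \<in> ?pZ" for x K
      proof -
        have "(x, K) \<in> p" "x \<in> Z" using that by auto
        then have "K \<subseteq> ball x (r x)" "ball x (r x) \<subseteq> U" using cell rZ by blast+
        then show ?thesis by (rule order_trans)
      qed
    qed
    ultimately show ?thesis by linarith
  qed
  also have "sum ?k p = (\<Sum>(x, K)\<in>p. \<phi> (Sup K) - \<phi> (Inf K)) + 2 * e * (\<Sum>(x, K)\<in>p. Sup K - Inf K)"
    by (simp add: case_prod_beta sum.distrib sum_distrib_left)
  also have "\<dots> = \<phi> b - \<phi> a + 2 * e * (b - a)"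
    using additive_tagged_division_1[OF \<open>a \<le> b\<close> p, of \<phi>]
      additive_tagged_division_1[OF \<open>a \<le> b\<close> p, of "\<lambda>x. x"] by simp
  finally show "norm (g b - g a) \<le> \<phi> b - \<phi> a + \<eta>" using e by simp
qed

text \<open>
  With the weight \<open>exp (2 * K * (s - a))\<close>, the maximum \<open>M\<close> of the weighted norm of \<open>g\<close> satisfies
  \<open>M \<le> M / 2\<close>: the hypothesis bounds the derivative by \<open>K * M * exp (2 * K * (s - a))\<close>, whose
  antiderivative carries the factor \<open>1 / (2 * K)\<close>. The weight makes one application of the mean
  value inequality cover an interval of any length.
\<close>

theorem abs_continuous_on_gronwall_zero:
  fixes g :: "real \<Rightarrow> 'a::real_normed_vector"
  assumes "K > 0" and ac: "abs_continuous_on {a..b} g"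
    and deriv: "AE t in lebesgue. t \<in> {a..b} \<longrightarrow>
      (\<exists>v. (g has_vector_derivative v) (at t within {a..b}) \<and> norm v \<le> K * norm (g t))"
    and "g a = 0" and t: "t \<in> {a..b}"
  shows "g t = 0"
proof -
  let ?E = "\<lambda>s. exp (2 * K * (s - a))"
  let ?q = "\<lambda>s. norm (g s) / ?E s"
  have "continuous_on {a..b} ?q"
    using abs_continuous_on_imp_continuous_on[OF ac] by (intro continuous_intros) auto
  then obtain s where s: "s \<in> {a..b}" and max: "\<And>y. y \<in> {a..b} \<Longrightarrow> ?q y \<le> ?q s"
    using continuous_attains_sup[of "{a..b}" ?q] t by fastforce
  define M where "M = ?q s"
  have gM: "norm (g y) \<le> M * ?E y" if "y \<in> {a..b}" for y
    using max[OF that] by (simp add: M_def pos_divide_le_eq)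
  have "M \<ge> 0" by (simp add: M_def)
  let ?\<phi> = "\<lambda>y. M / 2 * ?E y"
  have "norm (g s - g a) \<le> ?\<phi> s - ?\<phi> a"
  proof (rule abs_continuous_on_increment_le)
    have sub: "{a..s} \<subseteq> {a..b}" using s by auto
    show "a \<le> s" using s by simp
    show "abs_continuous_on {a..s} g" by (rule abs_continuous_on_subset[OF ac sub])
    show "mono_on {a..s} ?\<phi>"
      using \<open>M \<ge> 0\<close> \<open>K > 0\<close> by (intro mono_onI mult_left_mono) auto
    show "AE y in lebesgue. y \<in> {a..s} \<longrightarrow>
      (\<exists>v d. (g has_vector_derivative v) (at y within {a..s}) \<and>
             (?\<phi> has_vector_derivative d) (at y within {a..s}) \<and> norm v \<le> d)"
      using deriv
    proof eventually_elim
      case (elim y)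
      show ?case
      proof
        assume y: "y \<in> {a..s}"
        then have yb: "y \<in> {a..b}" using sub by blast
        with elim obtain v where v: "(g has_vector_derivative v) (at y within {a..b})"
          "norm v \<le> K * norm (g y)" by blast
        have "(?\<phi> has_real_derivative K * (M * ?E y)) (at y within {a..s})"
          by (auto intro!: derivative_eq_intros)
        then have "(?\<phi> has_vector_derivative K * (M * ?E y)) (at y within {a..s})"
          by (simp add: has_real_derivative_iff_has_vector_derivative)
        moreover have "norm v \<le> K * (M * ?E y)"
          using v(2) gM[OF yb] \<open>K > 0\<close> by (meson mult_left_mono less_imp_le order_trans)
        ultimately show "\<exists>v d. (g has_vector_derivative v) (at y within {a..s}) \<and>
             (?\<phi> has_vector_derivative d) (at y within {a..s}) \<and> norm v \<le> d"
          using has_vector_derivative_within_subset[OF v(1) sub] by blast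
      qed
    qed
  qed
  then have "norm (g s) \<le> M / 2 * ?E s" using \<open>g a = 0\<close> \<open>M \<ge> 0\<close> by simp
  moreover have "norm (g s) = M * ?E s" by (simp add: M_def)
  ultimately have "M * ?E s \<le> 0" by simp
  then have "M \<le> 0" by (simp add: mult_le_0_iff not_le[symmetric])
  then have "M * ?E t \<le> 0" by (simp add: mult_nonpos_nonneg)
  then have "norm (g t) \<le> 0" using gM[OF t] by (rule order_trans[rotated])
  then show ?thesis by simp
qed

section \<open>Policy matrices\<close>

lemma Cpol_mult_component:
  "(Cpol N \<pi> *v x) $ q =
     Cpol N \<pi> $ q $ q * x $ q +
     (if \<pi> q \<in> prio N \<and> q = qminus N (\<pi> q) \<and> qplus N (\<pi> q) \<noteq> q
      then real (ain N (qplus N (\<pi> q)) (\<pi> q)) * x $ qplus N (\<pi> q) else 0)"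
proof -
  have "(Cpol N \<pi> *v x) $ q = Cpol N \<pi> $ q $ q * x $ q + (\<Sum>q'\<in>UNIV - {q}. Cpol N \<pi> $ q $ q' * x $ q')"
    by (simp add: matrix_vector_mult_def sum.remove)
  also have "(\<Sum>q'\<in>UNIV - {q}. Cpol N \<pi> $ q $ q' * x $ q') =
      (\<Sum>q'\<in>UNIV - {q}. if q' = qplus N (\<pi> q)
         then (if \<pi> q \<in> prio N \<and> q = qminus N (\<pi> q) then real (ain N q' (\<pi> q)) * x $ q' else 0) else 0)"
    by (intro sum.cong) (auto simp: Cpol_def Let_def)
  finally show ?thesis by (auto simp: sum.delta)
qed

text \<open>
  A kernel vector vanishes at every transition whose row is diagonal, and the only off-diagonal
  entry of any other row sits in the column of such a transition.
\<close>

lemma invertible_Cpol: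
  assumes N: "petri_net N" and \<pi>: "policy N \<pi>"
  shows "invertible (Cpol N \<pi>)"
proof -
  have \<pi>in: "ain N q (\<pi> q) > 0" for q using \<pi> by (auto simp: policy_def q_in_def)
  have diag: "Cpol N \<pi> $ q $ q \<noteq> 0" for q
  proof -
    have "mu N q (\<pi> q) > 0" if "\<pi> q \<in> conflict N"
      using N that \<pi>in[of q] unfolding petri_net_def by (auto simp: p_out_def)
    then show ?thesis using \<pi>in[of q] by (auto simp: Cpol_def Let_def)
  qed
  have zero: "x = 0" if x: "Cpol N \<pi> *v x = 0" for x
  proof -
    have row: "Cpol N \<pi> $ q $ q * x $ q +
     (if \<pi> q \<in> prio N \<and> q = qminus N (\<pi> q) \<and> qplus N (\<pi> q) \<noteq> q
      then real (ain N (qplus N (\<pi> q)) (\<pi> q)) * x $ qplus N (\<pi> q) else 0) = 0" for q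
      using x Cpol_mult_component[of N \<pi> x q] by simp
    have first: "x $ q = 0" if "\<not> (\<pi> q \<in> prio N \<and> q = qminus N (\<pi> q))" for q
      using row[of q] diag[of q] that by auto
    have "x $ q = 0" for q
    proof (cases "\<pi> q \<in> prio N \<and> q = qminus N (\<pi> q)")
      case True
      let ?p = "\<pi> q" and ?q' = "qplus N (\<pi> q)"
      have ne: "?q' \<noteq> qminus N ?p" and out: "p_out N ?p = {?q', qminus N ?p}"
        using N True unfolding petri_net_def by auto
      have card: "card (q_in N ?q' \<inter> prio N) \<le> 1"
        using N unfolding petri_net_def by blast
      have "?p \<in> q_in N ?q' \<inter> prio N"
        using out True by (auto simp: p_out_def q_in_def)
      \<comment> \<open>If the policy place of \<open>?q'\<close> is subject to priority, it is \<open>?p\<close>, for which \<open>?q'\<close> is the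
        prioritised transition; so the row of \<open>?q'\<close> is diagonal in any case.\<close>
      then have "\<pi> ?q' = ?p" if "\<pi> ?q' \<in> prio N"
        using card that \<pi> by (auto simp: card_le_Suc0_iff_eq policy_def)
      then have "x $ ?q' = 0" using ne by (intro first) auto
      then show ?thesis using row[of q] diag[of q] by (auto split: if_splits)
    qed (rule first)
    then show ?thesis by (simp add: vec_eq_iff)
  qed
  then have "inj ((*v) (Cpol N \<pi>))"
    by (intro injI) (metis eq_iff_diff_eq_0 matrix_vector_mult_diff_distrib)
  then show ?thesis
    by (simp add: invertible_left_inverse matrix_left_invertible_injective)
qed

lemma matrix_inv_vector_cancel:
  fixes A :: "real ^ 'n ^ 'n"
  assumes "invertible A"
  shows "A *v (matrix_inv A *v x) = x" "matrix_inv A *v (A *v x) = x"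
proof -
  have "A ** matrix_inv A = mat 1 \<and> matrix_inv A ** A = mat 1"
    unfolding matrix_inv_def by (rule someI_ex) (use assms invertible_def in blast)
  then show "A *v (matrix_inv A *v x) = x" "matrix_inv A *v (A *v x) = x"
    by (simp_all add: matrix_vector_mul_assoc)
qed

lemma linear_over_tau: "linear (over_tau N)"
  by (rule linearI) (simp_all add: over_tau_def vec_eq_iff add_divide_distrib)

section \<open>The linear system of a policy\<close>

lemma linear_solution_unique:
  fixes N :: "('p::finite, 'q::finite) net"
  assumes inv: "invertible (Cpol N \<pi>)"
    and sol: "linear_solution N \<pi> {a..b} m w f"
    and sol': "linear_solution N \<pi> {a..b} m' w' f'"
    and init: "m' a = m a" "w' a = w a"
    and t: "t \<in> {a..b}"
  shows "m' t = m t \<and> w' t = w t \<and> f' t = f t"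
proof -
  define F where "F x = matrix_inv (Cpol N \<pi>) *v (Spol \<pi> *v over_tau N x)" for x
  define L where "L x = Cplus N *v F x - over_tau N x" for x
  have "linear F"
    unfolding F_def
    by (intro linear_compose[OF linear_compose[OF linear_over_tau matrix_vector_mul_linear]
          matrix_vector_mul_linear, unfolded o_def])
  have "linear L"
    unfolding L_def
    by (intro linear_compose_sub linear_over_tau
        linear_compose[OF \<open>linear F\<close> matrix_vector_mul_linear, unfolded o_def])
  then obtain K where "K > 0" and K: "\<And>x. norm (L x) \<le> K * norm x"
    by (rule linear_bounded_pos) blast
  have f: "f s = F (m s)" and f': "f' s = F (m' s)" if "s \<in> {a..b}" for s
    using sol sol' that matrix_inv_vector_cancel(2)[OF inv]
    unfolding linear_solution_def F_def by metis+
  have ac: "abs_continuous_on {a..b} (\<lambda>s. m' s - m s)" "abs_continuous_on {a..b} (\<lambda>s. w' s - w s)"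
    using sol sol' unfolding linear_solution_def locally_abs_continuous_on_def
    by (auto intro!: abs_continuous_on_diff)
  have AE: "AE s in lebesgue. s \<in> {a..b} \<longrightarrow>
       (m has_vector_derivative (Cplus N *v f s - over_tau N (m s))) (at s within {a..b}) \<and>
       (w has_vector_derivative (over_tau N (m s) - Cminus N *v f s)) (at s within {a..b})"
    "AE s in lebesgue. s \<in> {a..b} \<longrightarrow>
       (m' has_vector_derivative (Cplus N *v f' s - over_tau N (m' s))) (at s within {a..b}) \<and>
       (w' has_vector_derivative (over_tau N (m' s) - Cminus N *v f' s)) (at s within {a..b})"
    using sol sol' unfolding linear_solution_def by blast+
  have "m' s - m s = 0" if "s \<in> {a..b}" for s
  proof (rule abs_continuous_on_gronwall_zero[OF \<open>K > 0\<close> ac(1) _ _ that])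
    show "AE s in lebesgue. s \<in> {a..b} \<longrightarrow>
      (\<exists>v. ((\<lambda>s. m' s - m s) has_vector_derivative v) (at s within {a..b}) \<and>
           norm v \<le> K * norm (m' s - m s))"
      using AE
    proof eventually_elim
      case (elim s)
      show ?case
      proof
        assume s: "s \<in> {a..b}"
        have "(m has_vector_derivative L (m s)) (at s within {a..b})"
          "(m' has_vector_derivative L (m' s)) (at s within {a..b})"
          using elim s f f' by (auto simp: L_def)
        then have "((\<lambda>s. m' s - m s) has_vector_derivative L (m' s) - L (m s)) (at s within {a..b})"
          by (intro has_vector_derivative_diff)
        then show "\<exists>v. ((\<lambda>s. m' s - m s) has_vector_derivative v) (at s within {a..b}) \<and>
           norm v \<le> K * norm (m' s - m s)"
          using K[of "m' s - m s"] linear_diff[OF \<open>linear L\<close>] by metis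
      qed
    qed
  qed (use init in simp)
  then have m: "m' s = m s" if "s \<in> {a..b}" for s using that by simp
  \<comment> \<open>The derivative being \<open>0\<close> almost everywhere, any positive Gronwall constant serves below.\<close>
  have "w' t - w t = 0"
  proof (rule abs_continuous_on_gronwall_zero[OF zero_less_one ac(2) _ _ t])
    show "AE s in lebesgue. s \<in> {a..b} \<longrightarrow>
      (\<exists>v. ((\<lambda>s. w' s - w s) has_vector_derivative v) (at s within {a..b}) \<and>
           norm v \<le> 1 * norm (w' s - w s))"
      using AE
    proof eventually_elim
      case (elim s)
      show ?case
      proof
        assume s: "s \<in> {a..b}"
        then have "f' s = f s" using f f' m by simp
        then have "((\<lambda>s. w' s - w s) has_vector_derivative 0) (at s within {a..b})"
          using elim s m[OF s] by (metis (no_types) diff_self has_vector_derivative_diff)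
        then show "\<exists>v. ((\<lambda>s. w' s - w s) has_vector_derivative v) (at s within {a..b}) \<and>
           norm v \<le> 1 * norm (w' s - w s)" by (intro exI[of _ 0]) simp
      qed
    qed
  qed (use init in simp)
  then show ?thesis using m[OF t] f[OF t] f'[OF t] by simp
qed

theorem proposition4:
  fixes N :: "('p::finite, 'q::finite) net"
    and m w :: "real \<Rightarrow> real ^ 'p" and f :: "real \<Rightarrow> real ^ 'q"
    and \<pi> :: "'q \<Rightarrow> 'p" and t\<^sub>i t\<^sub>f :: real
  assumes "petri_net N"
    and "t\<^sub>i < t\<^sub>f"
    and "trajectory N {t\<^sub>i..t\<^sub>f} m w f"
    and "policy N \<pi>"
    and "\<And>t. t \<in> {t\<^sub>i..t\<^sub>f} \<Longrightarrow> reaches_infimum N \<pi> (m t) (w t) (f t)"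
  shows "linear_solution N \<pi> {t\<^sub>i..t\<^sub>f} m w f \<and>
    (\<forall>m' w' f'. linear_solution N \<pi> {t\<^sub>i..t\<^sub>f} m' w' f' \<and> m' t\<^sub>i = m t\<^sub>i \<and> w' t\<^sub>i = w t\<^sub>i \<longrightarrow>
       (\<forall>t\<in>{t\<^sub>i..t\<^sub>f}. m' t = m t \<and> w' t = w t \<and> f' t = f t))"
proof -
  have inv: "invertible (Cpol N \<pi>)" using assms(1,4) by (rule invertible_Cpol)
  have "linear_solution N \<pi> {t\<^sub>i..t\<^sub>f} m w f"
    using assms(3,5) matrix_inv_vector_cancel(1)[OF inv]
    unfolding linear_solution_def trajectory_def reaches_infimum_def by simp
  then show ?thesis using linear_solution_unique[OF inv] by blast
qed

end
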